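(* Let $g\ge 1$ and $k\ge 1$ be integers with $2g\ge k+2$. Then, as subspaces of $\mathfrak{h}^{\mathbb{Q}}_{g,1}(k)$, $$\mathrm{Ker}(c_k)\subset \mathrm{Ker}(\delta^{\mathrm{alg}}_k).$$
   Context: Let $H_{\mathbb{Q}}=H_1(\Sigma_{g,1};\mathbb{Q})$ for a compact oriented surface $\Sigma_{g,1}$ of genus $g$ with one boundary component; it has dimension $2g$ and carries the nondegenerate skew-symmetric intersection form $\langle\cdot,\cdot\rangle$. Identify $H_{\mathbb{Q}}$ with $H_{\mathbb{Q}}^*$ via $v\mapsto\langle v,\cdot\rangle$ (Poincaré duality); for $a\in H_\mathbb{Q}$ write $a^*=\langle a,\cdot\rangle$. Let $\mathcal{L}^{\mathbb{Q}}_{2g}(m)\subset H_{\mathbb{Q}}^{\otimes m}$ be the degree-$m$ part of the free Lie algebra on $H_\mathbb{Q}$, realized inside the tensor algebra as the span of left-normed brackets $[a_1,\dots,a_m]=[\cdots[[a_1,a_2],a_3],\dots,a_m]$ with $[x,y]=x\otimes y-y\otimes x$. Define $\mathfrak{h}^{\mathbb{Q}}_{g,1}(k)$ to be the kernel of the bracket map $H_\mathbb{Q}\otimes\mathcal{L}^{\mathbb{Q}}_{2g}(k+1)\to\mathcal{L}^{\mathbb{Q}}_{2g}(k+2)$, $X\otimes u\mapsto[X,u]$; it is a subspace of $H_\mathbb{Q}^{\otimes k+2}$. For $m\ge 0$, let $\mathcal{C}^{\mathbb{Q}}_{2g}(m)$ be the quotient of $H_\mathbb{Q}^{\otimes m}$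 by the span of all $a_1\otimes a_2\otimes\cdots\otimes a_m-a_2\otimes\cdots\otimes a_m\otimes a_1$ (so $\mathcal{C}^\mathbb{Q}_{2g}(0)=\mathbb{Q}$), with projection $\pi_m:H_\mathbb{Q}^{\otimes m}\to\mathcal{C}^\mathbb{Q}_{2g}(m)$; write $\pi$ for $\pi_m$ when $m$ is clear. The map $c_k:\mathfrak{h}^\mathbb{Q}_{g,1}(k)\to\mathcal{C}^\mathbb{Q}_{2g}(k)$ is the restriction of $a_0\otimes a_1\otimes\cdots\otimes a_{k+1}\mapsto \langle a_0,a_1\rangle\,\pi_k(a_2\otimes\cdots\otimes a_{k+1})$. The map $\delta_k^{\mathrm{alg}}:H_\mathbb{Q}^{\otimes k+2}\to\bigoplus_{p,q\ge1,\,p+q=k}\mathcal{C}^\mathbb{Q}_{2g}(p)\otimes\mathcal{C}^\mathbb{Q}_{2g}(q)$ sends $a_1\otimes\cdots\otimes a_{k+2}$ to $$\sum_{\substack{1\le i<j\le k+2\\ 1<j-i<k+1}} a_i^*(a_j)\Big(\pi(a_{i+1}\otimes\cdots\otimes a_{j-1})\otimes\pi(a_{j+1}\otimes\cdots\otimes a_{k+2}\otimes a_1\otimes\cdots\otimes a_{i-1}) - \pi(a_{j+1}\otimes\cdots\otimes a_{k+2}\otimes a_1\otimes\cdots\otimes a_{i-1})\otimes\pi(a_{i+1}\otimes\cdots\otimes a_{j-1})\Big);$$ the same symbol denotes its restriction to $\mathfrak{h}^\mathbb{Q}_{g,1}(k)$. (For $k=1$ the target is $0$.) *)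

theory Defs
  imports Complex_Main
begin

text \<open>Concrete model. H_Q = Q^{2g} with basis e_0,...,e_{2g-1}; a vector is a function
  nat => rat supported in {..<2g}. The intersection form is the standard symplectic form
  <e_{2i}, e_{2i+1}> = 1, <e_{2i+1}, e_{2i}> = -1, all other basis pairings 0.
  A tensor in H^{(x)m} is a function nat list => rat (coefficients w.r.t. the basis words),
  supported on words of length m with letters < 2g.  Elements of a direct sum of
  tensor products H^{(x)p} (x) H^{(x)q} are functions on pairs of words.\<close>

definition vecs :: "nat \<Rightarrow> (nat \<Rightarrow> rat) set" where
  "vecs g = {v. \<forall>i. v i \<noteq> 0 \<longrightarrow> i < 2 * g}"

definition words :: "nat \<Rightarrow> nat \<Rightarrow> nat list set" where
  "words g n = {w. length w = n \<and> set w \<subseteq> {..<2 * g}}"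

definition omega :: "nat \<Rightarrow> nat \<Rightarrow> nat \<Rightarrow> rat" where
  "omega g i j = (if i < 2 * g \<and> j < 2 * g then
      (if even i \<and> j = i + 1 then 1 else if odd i \<and> i = j + 1 then -1 else 0) else 0)"

definition lin_span :: "('a \<Rightarrow> rat) set \<Rightarrow> ('a \<Rightarrow> rat) set" where
  "lin_span S = {x. \<exists>t r. finite t \<and> t \<subseteq> S \<and> (\<forall>w. x w = (\<Sum>a\<in>t. r a * a w))}"

definition etens :: "(nat \<Rightarrow> rat) list \<Rightarrow> nat list \<Rightarrow> rat" where
  "etens as w = (if length w = length as then (\<Prod>i<length w. (as ! i) (w ! i)) else 0)"

definition deg1 :: "(nat \<Rightarrow> rat) \<Rightarrow> nat list \<Rightarrow> rat" where
  "deg1 v w = (case w of [i] \<Rightarrow> v i | _ \<Rightarrow> 0)"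

definition tmul :: "(nat list \<Rightarrow> rat) \<Rightarrow> (nat list \<Rightarrow> rat) \<Rightarrow> nat list \<Rightarrow> rat" where
  "tmul f h w = (\<Sum>i\<le>length w. f (take i w) * h (drop i w))"

definition brk :: "(nat list \<Rightarrow> rat) \<Rightarrow> (nat list \<Rightarrow> rat) \<Rightarrow> nat list \<Rightarrow> rat" where
  "brk f h w = tmul f h w - tmul h f w"

fun lnb :: "(nat \<Rightarrow> rat) list \<Rightarrow> nat list \<Rightarrow> rat" where
  "lnb [] = (\<lambda>w. 0)"
| "lnb (a # as) = foldl (\<lambda>x b. brk x (deg1 b)) (deg1 a) as"

definition freeLie :: "nat \<Rightarrow> nat \<Rightarrow> (nat list \<Rightarrow> rat) set" where
  "freeLie g m = lin_span {lnb as | as. length as = m \<and> set as \<subseteq> vecs g}"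

definition HtensL :: "nat \<Rightarrow> nat \<Rightarrow> (nat list \<Rightarrow> rat) set" where
  "HtensL g k = lin_span {tmul (deg1 X) u | X u. X \<in> vecs g \<and> u \<in> freeLie g (k + 1)}"

text \<open>Linear extension of X (x) u |-> [X,u] = X (x) u - u (x) X on H (x) H^{(x)n}.\<close>
definition bracket_map :: "(nat list \<Rightarrow> rat) \<Rightarrow> nat list \<Rightarrow> rat" where
  "bracket_map x w = (if w = [] then 0 else x w - x (last w # butlast w))"

definition hQ :: "nat \<Rightarrow> nat \<Rightarrow> (nat list \<Rightarrow> rat) set" where
  "hQ g k = {x \<in> HtensL g k. \<forall>w. bracket_map x w = 0}"

text \<open>Kernel of the projection pi_m : H^{(x)m} -> C(m).\<close>
definition cyc_rel :: "nat \<Rightarrow> nat \<Rightarrow> (nat list \<Rightarrow> rat) set" where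
  "cyc_rel g m = lin_span {(\<lambda>w. etens as w - etens (rotate1 as) w) | as.
                     length as = m \<and> set as \<subseteq> vecs g}"

text \<open>Lift of c_k to H^{(x)(k+2)} -> H^{(x)k}: a_0 (x) a_1 (x) rest |-> <a_0,a_1> rest.
  c_k(x) = pi_k (clift g x).\<close>
definition clift :: "nat \<Rightarrow> (nat list \<Rightarrow> rat) \<Rightarrow> nat list \<Rightarrow> rat" where
  "clift g x w = (\<Sum>i<2 * g. \<Sum>j<2 * g. omega g i j * x (i # j # w))"

definition ptens :: "(nat list \<Rightarrow> rat) \<Rightarrow> (nat list \<Rightarrow> rat) \<Rightarrow> nat list \<times> nat list \<Rightarrow> rat" where
  "ptens f h uv = f (fst uv) * h (snd uv)"

text \<open>Kernel of the projection from the direct sum over p+q=k, p,q>=1, of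
  H^{(x)p} (x) H^{(x)q} onto the direct sum of C(p) (x) C(q).\<close>
definition cyc_rel2 :: "nat \<Rightarrow> nat \<Rightarrow> (nat list \<times> nat list \<Rightarrow> rat) set" where
  "cyc_rel2 g k = lin_span
     ({(\<lambda>uv. ptens (etens as) (etens bs) uv - ptens (etens (rotate1 as)) (etens bs) uv) | as bs.
        1 \<le> length as \<and> 1 \<le> length bs \<and> length as + length bs = k \<and>
        set as \<subseteq> vecs g \<and> set bs \<subseteq> vecs g}
    \<union> {(\<lambda>uv. ptens (etens as) (etens bs) uv - ptens (etens as) (etens (rotate1 bs)) uv) | as bs.
        1 \<le> length as \<and> 1 \<le> length bs \<and> length as + length bs = k \<and>
        set as \<subseteq> vecs g \<and> set bs \<subseteq> vecs g})"

text \<open>Lift of delta_k^alg, defined on basis words (0-indexed positions i<j<=k+1 with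
  1 < j-i < k+1) and extended linearly; delta_k^alg(x) is its image in the direct sum
  of C(p) (x) C(q).\<close>
definition delta_lift :: "nat \<Rightarrow> nat \<Rightarrow> (nat list \<Rightarrow> rat) \<Rightarrow> nat list \<times> nat list \<Rightarrow> rat" where
  "delta_lift g k x uv = (\<Sum>w\<in>words g (k + 2). x w *
     (\<Sum>(i, j)\<in>{(i, j). i < j \<and> j < k + 2 \<and> 1 < j - i \<and> j - i < k + 1}.
        omega g (w ! i) (w ! j) *
        ((if uv = (take (j - i - 1) (drop (i + 1) w), drop (j + 1) w @ take i w) then 1 else 0)
       - (if uv = (drop (j + 1) w @ take i w, take (j - i - 1) (drop (i + 1) w)) then 1 else 0))))"

end

theory Submission
  imports Defs "HOL-Library.Function_Algebras"
begin

text \<open>Let \<open>d u\<close> be the contraction of a vector with the first letter of a Lie element \<open>u\<close>, and \<open>D u\<close>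
  the sum, over all occurrences of a contracted letter, of (prefix) \<open>\<otimes>\<close> (suffix). The Lie algebra acts
  on \<open>T \<otimes> T\<close> through the inner bimodule structure, so \<open>D u = (S \<otimes> id) \<Delta> (d u)\<close> with \<open>\<Delta>\<close> the
  coproduct dual to the shuffle product and \<open>S\<close> the antipode of the tensor algebra. Since \<open>\<Delta>\<close> is an
  algebra map and \<open>S\<close> an antiautomorphism, \<open>(S \<otimes> id) \<Delta>\<close> descends to cyclic words; hence the
  cyclic class of the full contraction \<open>D\<close> is determined by \<open>c\<^sub>k\<close>. Elements of the kernel of the
  bracket are cyclically invariant, so all pairs of positions contribute equally to the cobracket,
  which is thus \<open>k + 2\<close> times the class of \<open>D\<close>.\<close>

section \<open>Linear spans of rational-valued functions\<close>

interpretation fun_vs: vector_space "\<lambda>(c::rat) (f::'a \<Rightarrow> rat) w. c * f w"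
  by unfold_locales (auto simp: fun_eq_iff algebra_simps)

lemma lin_span_eq_span: "lin_span S = fun_vs.span S"
proof -
  have eq: "(\<forall>w. x w = (\<Sum>a\<in>t. r a * a w)) \<longleftrightarrow> x = (\<Sum>a\<in>t. (\<lambda>w. r a * a w))"
    for x :: "'a \<Rightarrow> rat" and t r
  proof -
    have "(\<Sum>a\<in>t. (\<lambda>w. r a * a w)) w = (\<Sum>a\<in>t. r a * a w)" for w
      by (induction t rule: infinite_finite_induct) auto
    then show ?thesis by (simp add: fun_eq_iff)
  qed
  show ?thesis
    unfolding lin_span_def fun_vs.span_explicit eq by blast
qed

lemma lin_span_induct [consumes 1, case_names zero step]:
  assumes "x \<in> lin_span S" "P (\<lambda>w. 0)"
    "\<And>c a y. a \<in> S \<Longrightarrow> P y \<Longrightarrow> P (\<lambda>w. c * a w + y w)"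
  shows "P x"
  using assms(1) unfolding lin_span_eq_span
proof (induction rule: fun_vs.span_induct_alt)
  case base
  then show ?case using assms(2) by (simp add: zero_fun_def)
next
  case (step c a y)
  then show ?case using assms(3)[of a y c] by (simp add: plus_fun_def)
qed

lemma sum_lessThan_cyclic_shift:
  fixes h :: "nat \<Rightarrow> 'a::comm_monoid_add"
  assumes "h n = h 0"
  shows "(\<Sum>i<n. h (Suc i)) = (\<Sum>i<n. h i)"
proof (cases n)
  case (Suc m)
  then show ?thesis using assms
    by (simp add: sum.lessThan_Suc_shift[of h m] add.commute del: sum.lessThan_Suc)
       (simp add: add.commute)
qed simp

section \<open>Shuffle sums and Lie elements\<close>

text \<open>The linear extension of \<open>f\<close> evaluated on the shuffle product of the two
  words, with multiplicity. Dually, this is the coefficient at \<open>p\<close> \<otimes>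
  \<open>q\<close> of the coproduct of the tensor \<open>f\<close> in which letters are
  primitive.\<close>

fun shuffle_sum :: "('a list \<Rightarrow> rat) \<Rightarrow> 'a list \<Rightarrow> 'a list \<Rightarrow> rat" where
  "shuffle_sum f [] q = f q"
| "shuffle_sum f (a # p) [] = f (a # p)"
| "shuffle_sum f (a # p) (b # q) =
     shuffle_sum (\<lambda>w. f (a # w)) p (b # q) + shuffle_sum (\<lambda>w. f (b # w)) (a # p) q"

lemma shuffle_sum_Nil_right [simp]: "shuffle_sum f p [] = f p"
  by (cases p) auto

lemma shuffle_sum_zero [simp]: "shuffle_sum (\<lambda>w. 0) p q = 0"
  by (induction "\<lambda>w::'a list. 0::rat" p q rule: shuffle_sum.induct) auto

lemma shuffle_sum_add:
  "shuffle_sum (\<lambda>w. f w + h w) p q = shuffle_sum f p q + shuffle_sum h p q"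
  by (induction f p q arbitrary: h rule: shuffle_sum.induct) simp_all

lemma shuffle_sum_diff:
  "shuffle_sum (\<lambda>w. f w - h w) p q = shuffle_sum f p q - shuffle_sum h p q"
  by (induction f p q arbitrary: h rule: shuffle_sum.induct) simp_all

lemma shuffle_sum_mult:
  "shuffle_sum (\<lambda>w. c * f w) p q = c * shuffle_sum f p q"
  by (induction f p q rule: shuffle_sum.induct) (auto simp: algebra_simps)

lemma shuffle_sum_sum:
  "shuffle_sum (\<lambda>w. \<Sum>i\<in>I. f i w) p q = (\<Sum>i\<in>I. shuffle_sum (f i) p q)"
  by (induction I rule: infinite_finite_induct) (auto simp: shuffle_sum_add)

text \<open>The recursion in the definition sorts shuffles by their first letter; this is the mirror
  form, by last letter. It holds because peeling off a first letter commutes with peeling off a last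
  one. It serves both right brackets and rotations.\<close>

lemma shuffle_sum_snoc:
  "shuffle_sum f (p @ [a]) (q @ [b]) =
     shuffle_sum (\<lambda>w. f (w @ [a])) p (q @ [b]) + shuffle_sum (\<lambda>w. f (w @ [b])) (p @ [a]) q"
proof (induction "length p + length q" arbitrary: f p q)
  case 0
  then show ?case by simp
next
  case (Suc n)
  show ?case
  proof (cases p)
    case p: Nil
    show ?thesis
    proof (cases q)
      case (Cons y q')
      then show ?thesis using p Suc(2) Suc(1)[of "[]" q' "\<lambda>w. f (y # w)"] by simp
    qed (use p Suc in simp)
  next
    case p: (Cons x p')
    show ?thesis
    proof (cases q)
      case Nil
      then show ?thesis using p Suc(2) Suc(1)[of p' "[]" "\<lambda>w. f (x # w)"] by simp
    next
      case q: (Cons y q')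
      show ?thesis
        using p q Suc(2) Suc(1)[of p' q "\<lambda>w. f (x # w)"] Suc(1)[of p q' "\<lambda>w. f (y # w)"]
        by simp
    qed
  qed
qed

text \<open>The image of a primitive element under the antipode in its left tensor factor: reading a
  Lie element from an interior letter \<open>j\<close> amounts to reading it from the front, shuffling the
  reversed prefix into the suffix.\<close>
definition lie_like :: "('a list \<Rightarrow> rat) \<Rightarrow> bool" where
  "lie_like u \<longleftrightarrow> u [] = 0 \<and>
     (\<forall>p j q. u (p @ j # q) = (- 1) ^ length p * shuffle_sum (\<lambda>w. u (j # w)) (rev p) q)"

lemma lie_likeD:
  assumes "lie_like u"
  shows "shuffle_sum (\<lambda>w. u (j # w)) p q = (- 1) ^ length p * u (rev p @ j # q)"
proof -
  have "u (rev p @ j # q) = (- 1) ^ length p * shuffle_sum (\<lambda>w. u (j # w)) p q"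
    using assms unfolding lie_like_def by (metis length_rev rev_rev_ident)
  then show ?thesis
    by (simp flip: mult.assoc power_mult_distrib)
qed

text \<open>Ree's criterion: Lie elements annihilate proper shuffles. Sorting by the first letter
  gives two sums, which both equal \<open>u (rev p' @ a # b # q')\<close> up to sign; the reversed
  prefixes differ in length by one, so the signs are opposite.\<close>

lemma lie_like_shuffle_sum_eq_0:
  assumes "lie_like u" "p \<noteq> []" "q \<noteq> []"
  shows "shuffle_sum u p q = 0"
proof -
  obtain a p' b q' where "p = a # p'" "q = b # q'"
    using assms(2,3) by (meson neq_Nil_conv)
  then show ?thesis by (simp add: lie_likeD[OF assms(1)])
qed

text \<open>The antipode is -1 on primitive elements; this is the criterion with an empty
  suffix.\<close>

lemma lie_like_reverse:
  assumes "lie_like u"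
  shows "u (rev p) = - ((- 1) ^ length p * u p)"
proof (cases p)
  case Nil
  then show ?thesis using assms by (simp add: lie_like_def)
next
  case (Cons a p')
  then show ?thesis using lie_likeD[OF assms, of a p' "[]"]
    by (simp flip: mult.assoc power_mult_distrib)
qed

section \<open>Left-normed brackets satisfy the front-reading identity\<close>

lemma deg1_eq_0: "length w \<noteq> 1 \<Longrightarrow> deg1 v w = 0"
  by (auto simp: deg1_def split: list.splits)

lemma tmul_deg1_right: "tmul f (deg1 v) (w @ [y]) = f w * v y"
proof -
  have "f (take i (w @ [y])) * deg1 v (drop i (w @ [y])) = (if i = length w then f w * v y else 0)"
    for i
  proof (cases "i = length w")
    case False
    then have "length (drop i (w @ [y])) \<noteq> 1" by simp
    then have "deg1 v (drop i (w @ [y])) = 0" by (rule deg1_eq_0)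
    then show ?thesis using False by simp
  qed (simp add: deg1_def)
  then show ?thesis by (simp add: tmul_def)
qed

lemma tmul_deg1_left: "tmul (deg1 v) f (y # w) = v y * f w"
proof -
  have "deg1 v (take i (y # w)) * f (drop i (y # w)) = (if i = Suc 0 then v y * f w else 0)"
    if "i \<le> Suc (length w)" for i
  proof (cases "i = Suc 0")
    case False
    then have "length (take i (y # w)) \<noteq> 1" using that by simp
    then have "deg1 v (take i (y # w)) = 0" by (rule deg1_eq_0)
    then show ?thesis using False by simp
  qed (simp add: deg1_def)
  then have "tmul (deg1 v) f (y # w) = (\<Sum>i\<le>Suc (length w). if i = Suc 0 then v y * f w else 0)"
    unfolding tmul_def by (intro sum.cong) auto
  also have "\<dots> = v y * f w"
    by (subst sum.delta) auto
  finally show ?thesis .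
qed

lemma brk_deg1_Nil: "brk f (deg1 v) [] = 0"
  by (simp add: brk_def tmul_def deg1_def)

lemma brk_deg1_Cons_snoc: "brk f (deg1 v) (x # w @ [y]) = f (x # w) * v y - v x * f (w @ [y])"
  using tmul_deg1_right[of f v "x # w" y] tmul_deg1_left[of v f x "w @ [y]"] by (simp add: brk_def)

lemma lie_like_deg1: "lie_like (deg1 v)"
proof -
  have *: "shuffle_sum f p q = 0" if "\<And>w. w \<noteq> [] \<Longrightarrow> f w = 0" "p \<noteq> []"
    for f :: "nat list \<Rightarrow> rat" and p q
    using that
  proof (induction f p q rule: shuffle_sum.induct)
    case (3 f a p b q)
    have "(\<lambda>w. f (a # w)) = (\<lambda>w. 0)" "(\<lambda>w. f (b # w)) = (\<lambda>w. 0)" using 3 by auto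
    then show ?case by simp
  qed auto
  have "deg1 v (p @ j # q) = (- 1) ^ length p * shuffle_sum (\<lambda>w. deg1 v (j # w)) (rev p) q"
    for p j q
  proof (cases "p = []")
    case False
    then have "shuffle_sum (\<lambda>w. deg1 v (j # w)) (rev p) q = 0"
      by (intro *) (auto intro: deg1_eq_0)
    moreover have "deg1 v (p @ j # q) = 0"
      using False by (intro deg1_eq_0) (cases p; simp)
    ultimately show ?thesis by simp
  qed simp
  then show ?thesis unfolding lie_like_def by (auto intro: deg1_eq_0)
qed

text \<open>The shuffles are sorted by their last letter, which is the first letter of
  \<open>p\<close> or the last letter of \<open>q\<close>. Terms with \<open>v\<close> evaluated at
  that letter reproduce the two terms of the bracket at \<open>p @ j # q\<close>. Terms with
  \<open>v\<close> evaluated at \<open>j\<close> reassemble into the shuffle sum of \<open>u\<close>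
  itself, which vanishes by Ree's criterion.\<close>

lemma lie_like_brk_deg1:
  assumes u: "lie_like u"
  shows "lie_like (brk u (deg1 v))"
proof -
  let ?b = "brk u (deg1 v)"
  have "?b (p @ j # q) = (- 1) ^ length p * shuffle_sum (\<lambda>w. ?b (j # w)) (rev p) q" for p j q
  proof (cases p)
    case Nil
    then show ?thesis by simp
  next
    case p: (Cons x p')
    show ?thesis
    proof (cases q rule: rev_cases)
      \<comment> \<open>With an empty suffix there is no proper shuffle to annihilate; the reversal
        rule takes the place of Ree's criterion.\<close>
      case Nil
      have "?b (p @ j # q) = u p * v j - v x * u (p' @ [j])"
        using brk_deg1_Cons_snoc[of u v x p' j] p Nil by simp
      moreover have "u (p' @ [j]) = (- 1) ^ length p' * u (j # rev p')"
        using u unfolding lie_like_def by (metis append_Nil shuffle_sum_Nil_right)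
      moreover have "?b (j # rev p) = u (j # rev p') * v x - v j * u (rev p)"
        using brk_deg1_Cons_snoc[of u v j "rev p'" x] p by simp
      ultimately show ?thesis
        using p Nil lie_like_reverse[OF u, of p]
        by (cases "even (length p')") (auto simp: algebra_simps)
    next
      case q: (snoc q' y)
      have "(\<lambda>w. ?b (j # w @ [z])) = (\<lambda>w. v z * u (j # w) - v j * u (w @ [z]))" for z
        by (simp add: brk_deg1_Cons_snoc fun_eq_iff)
      then have "shuffle_sum (\<lambda>w. ?b (j # w)) (rev p) q
         = v x * shuffle_sum (\<lambda>w. u (j # w)) (rev p') q + v y * shuffle_sum (\<lambda>w. u (j # w)) (rev p) q'
           - v j * shuffle_sum u (rev p) q"
        using p q by (simp add: shuffle_sum_snoc shuffle_sum_diff shuffle_sum_mult algebra_simps)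
      moreover have "shuffle_sum u (rev p) q = 0"
        by (rule lie_like_shuffle_sum_eq_0[OF u]) (use p q in auto)
      ultimately have "shuffle_sum (\<lambda>w. ?b (j # w)) (rev p) q
         = v x * ((- 1) ^ length p' * u (p' @ j # q)) + v y * ((- 1) ^ length p * u (p @ j # q'))"
        by (simp add: lie_likeD[OF u])
      moreover have "?b (p @ j # q) = u (p @ j # q') * v y - v x * u (p' @ j # q)"
        using brk_deg1_Cons_snoc[of u v x "p' @ j # q'" y] p q by simp
      ultimately show ?thesis
        using p by (cases "even (length p')") (auto simp: algebra_simps)
    qed
  qed
  then show ?thesis unfolding lie_like_def by (auto simp: brk_deg1_Nil)
qed

lemma lie_like_zero: "lie_like (\<lambda>w. 0)"
  by (simp add: lie_like_def)

lemma lie_like_lnb: "lie_like (lnb as)"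
proof (cases as)
  case (Cons a bs)
  have "lie_like (foldl (\<lambda>x b. brk x (deg1 b)) u bs)" if "lie_like u" for u
    using that by (induction bs arbitrary: u) (auto intro: lie_like_brk_deg1)
  then show ?thesis using Cons lie_like_deg1 by simp
qed (simp add: lie_like_zero)

lemma lie_like_add_mult:
  assumes "lie_like f" "lie_like h"
  shows "lie_like (\<lambda>w. c * f w + h w)"
  using assms unfolding lie_like_def
  by (auto simp: shuffle_sum_add shuffle_sum_mult algebra_simps)

lemma lie_like_freeLie: "u \<in> freeLie g m \<Longrightarrow> lie_like u"
  unfolding freeLie_def
  by (induction rule: lin_span_induct) (auto intro: lie_like_add_mult lie_like_lnb lie_like_zero)

text \<open>Fixing the letter in the factor H leaves a combination of Lie elements.\<close>

lemma lie_like_HtensL_slice: "x \<in> HtensL g k \<Longrightarrow> lie_like (\<lambda>w. x (a # w))"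
  unfolding HtensL_def
proof (induction rule: lin_span_induct)
  case (step c t y)
  then obtain X u where t: "t = tmul (deg1 X) u" and "u \<in> freeLie g (k + 1)" by blast
  then have "lie_like (\<lambda>w. (c * X a) * u w + y (a # w))"
    using step lie_like_add_mult lie_like_freeLie by blast
  then show ?case by (simp add: t tmul_deg1_left mult.assoc)
qed (simp add: lie_like_zero)

text \<open>The coefficient at \<open>p\<close> \<otimes> \<open>q\<close> of the full contraction
  \<open>D\<close>: the first letter is contracted with the letter that separates \<open>p\<close>
  from \<open>q\<close>. For empty \<open>p\<close> this is \<open>clift\<close>.\<close>

definition double_contraction :: "nat \<Rightarrow> (nat list \<Rightarrow> rat) \<Rightarrow> nat list \<Rightarrow> nat list \<Rightarrow> rat" where
  "double_contraction g x p q = (\<Sum>i<2 * g. \<Sum>j<2 * g. omega g i j * x (i # p @ j # q))"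

text \<open>For each first letter \<open>i\<close> the remaining tensor is a Lie element, so a
  contracted letter in the interior can be moved to the front. Hence contraction with the adjacent
  letter determines all other contractions.\<close>

lemma double_contraction_eq_shuffle_sum:
  assumes "x \<in> HtensL g k"
  shows "double_contraction g x p q = (- 1) ^ length p * shuffle_sum (clift g x) (rev p) q"
proof -
  have "x (i # p @ j # q) = (- 1) ^ length p * shuffle_sum (\<lambda>w. x (i # j # w)) (rev p) q" for i j
    using lie_like_HtensL_slice[OF assms, of i] unfolding lie_like_def by blast
  then have "double_contraction g x p q =
    (- 1) ^ length p * (\<Sum>i<2 * g. \<Sum>j<2 * g. omega g i j * shuffle_sum (\<lambda>w. x (i # j # w)) (rev p) q)"
    by (simp add: double_contraction_def sum_distrib_left algebra_simps)
  moreover have "clift g x = (\<lambda>w. \<Sum>i<2 * g. \<Sum>j<2 * g. omega g i j * x (i # j # w))"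
    by (simp add: clift_def fun_eq_iff)
  ultimately show ?thesis by (simp add: shuffle_sum_sum shuffle_sum_mult)
qed

section \<open>Rotations\<close>

lemma etens_rotate1: "etens (rotate1 as) (rotate1 w) = etens as w"
proof (cases "length w = length as \<and> w \<noteq> []")
  case True
  then obtain a as' b w' where aw: "as = a # as'" "w = b # w'" "length w' = length as'"
    by (cases as; cases w) auto
  have "(\<Prod>i<length w'. ((as' @ [a]) ! i) ((w' @ [b]) ! i)) = (\<Prod>i<length w'. (as' ! i) (w' ! i))"
    using aw by (intro prod.cong) (auto simp: nth_append)
  then have "etens (rotate1 as) (rotate1 w) = (\<Prod>i<length w'. (as' ! i) (w' ! i)) * a b"
    using aw by (simp add: etens_def) (simp add: nth_append)
  also have "\<dots> = etens as w"
    using aw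
    by (simp add: etens_def prod.lessThan_Suc_shift[of _ "length as'"] mult.commute
        del: prod.lessThan_Suc)
  finally show ?thesis .
next
  case False
  then show ?thesis by (cases w) (auto simp: etens_def)
qed

text \<open>Summing over all \<open>k\<close> rotations is a cyclically invariant functional, so it
  kills the generators. On words of any other length the generators are 0 by the default value of
  \<open>etens\<close>.\<close>

lemma cyc_rel_rotation_sum:
  assumes "f \<in> cyc_rel g k"
  shows "(\<Sum>i<k. f (rotate i w)) = 0"
  using assms unfolding cyc_rel_def
proof (induction rule: lin_span_induct)
  case zero
  then show ?case by simp
next
  case (step c t y)
  then obtain as where t: "t = (\<lambda>w. etens as w - etens (rotate1 as) w)" and as: "length as = k"
    by blast
  have "(\<Sum>i<k. etens as (rotate i w)) = (\<Sum>i<k. etens (rotate1 as) (rotate (Suc i) w))"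
    by (simp add: etens_rotate1)
  also have "\<dots> = (\<Sum>i<k. etens (rotate1 as) (rotate i w))"
  proof (cases "length w = k")
    case True
    then show ?thesis
      using sum_lessThan_cyclic_shift[of "\<lambda>i. etens (rotate1 as) (rotate i w)" k] by simp
  qed (simp add: etens_def as)
  finally have "(\<Sum>i<k. t (rotate i w)) = 0" by (simp add: t sum_subtractf)
  then show ?case using step by (simp add: sum.distrib flip: sum_distrib_left)
qed

text \<open>Rotating a shuffle sends its first letter, a head of \<open>p\<close> or
  \<open>q\<close>, to the end; rotating both words first puts the same heads at the end. The two
  expansions differ only by a rotation of the word that did not supply the letter.\<close>

lemma shuffle_sum_rotate1:
  assumes "p \<noteq> []" "q \<noteq> []"
  shows "shuffle_sum (\<lambda>w. f (rotate1 w)) p q =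
    shuffle_sum (\<lambda>w. f (w @ [hd p])) (tl p) q + shuffle_sum (\<lambda>w. f (w @ [hd q])) p (tl q)"
    "shuffle_sum f (rotate1 p) (rotate1 q) =
    shuffle_sum (\<lambda>w. f (w @ [hd p])) (tl p) (rotate1 q) + shuffle_sum (\<lambda>w. f (w @ [hd q])) (rotate1 p) (tl q)"
  using assms by (cases p; cases q; simp add: shuffle_sum_snoc)+

text \<open>Summing over all rotations of both words absorbs the remaining rotation in each
  expansion. This is the descent of the coproduct to cyclic words.\<close>

lemma rotation_sum_shuffle_sum_rotate1:
  assumes "p \<noteq> []" "q \<noteq> []"
  shows "(\<Sum>i<length p. \<Sum>j<length q. shuffle_sum (\<lambda>w. f (rotate1 w)) (rotate i p) (rotate j q))
    = (\<Sum>i<length p. \<Sum>j<length q. shuffle_sum f (rotate i p) (rotate j q))" (is "?L = ?R")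
proof -
  let ?A = "\<lambda>i q'. shuffle_sum (\<lambda>w. f (w @ [hd (rotate i p)])) (tl (rotate i p)) q'"
  let ?B = "\<lambda>j p'. shuffle_sum (\<lambda>w. f (w @ [hd (rotate j q)])) p' (tl (rotate j q))"
  have cyc: "(\<Sum>i<length r. h (rotate (Suc i) r)) = (\<Sum>i<length r. h (rotate i r))"
    for h :: "'a list \<Rightarrow> rat" and r
    by (rule sum_lessThan_cyclic_shift[of "\<lambda>i. h (rotate i r)"]) simp
  have "?R = (\<Sum>i<length p. \<Sum>j<length q. shuffle_sum f (rotate (Suc i) p) (rotate (Suc j) q))"
    unfolding cyc[of "\<lambda>p'. \<Sum>j<length q. shuffle_sum f p' (rotate (Suc j) q)"]
    by (rule sum.cong[OF refl], rule cyc[symmetric])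
  also have "\<dots> = (\<Sum>i<length p. \<Sum>j<length q. ?A i (rotate (Suc j) q)) +
      (\<Sum>i<length p. \<Sum>j<length q. ?B j (rotate (Suc i) p))"
    using assms by (simp add: shuffle_sum_rotate1 sum.distrib)
  also have "(\<Sum>i<length p. \<Sum>j<length q. ?A i (rotate (Suc j) q)) =
      (\<Sum>i<length p. \<Sum>j<length q. ?A i (rotate j q))"
    by (rule sum.cong[OF refl], rule cyc)
  also have "(\<Sum>i<length p. \<Sum>j<length q. ?B j (rotate (Suc i) p)) =
      (\<Sum>i<length p. \<Sum>j<length q. ?B j (rotate i p))"
    by (rule cyc[of "\<lambda>p'. \<Sum>j<length q. ?B j p'"])
  also have "(\<Sum>i<length p. \<Sum>j<length q. ?A i (rotate j q)) +
      (\<Sum>i<length p. \<Sum>j<length q. ?B j (rotate i p)) = ?L"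
    using assms by (simp add: shuffle_sum_rotate1 sum.distrib)
  finally show ?thesis by simp
qed

text \<open>All \<open>n\<close> rotations of \<open>f\<close> have the same double rotation sum,
  while their total is zero; dividing by \<open>n\<close> gives the claim.\<close>

lemma rotation_sum_shuffle_sum_eq_0:
  assumes "p \<noteq> []" "q \<noteq> []" and f: "\<And>w. (\<Sum>i<n. f (rotate i w)) = 0" and "n > 0"
  shows "(\<Sum>i<length p. \<Sum>j<length q. shuffle_sum f (rotate i p) (rotate j q)) = 0"
proof -
  let ?S = "\<lambda>f. \<Sum>i<length p. \<Sum>j<length q. shuffle_sum f (rotate i p) (rotate j q)"
  have rot: "?S (\<lambda>w. f (rotate m w)) = ?S f" for m
  proof (induction m)
    case (Suc m)
    then show ?case
      using rotation_sum_shuffle_sum_rotate1[OF assms(1,2), of "\<lambda>w. f (rotate m w)"]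
      by (simp add: rotate1_rotate_swap)
  qed simp
  have "0 = ?S (\<lambda>w. \<Sum>m<n. f (rotate m w))" by (simp add: f)
  also have "\<dots> = (\<Sum>i<length p. \<Sum>m<n. \<Sum>j<length q. shuffle_sum (\<lambda>w. f (rotate m w)) (rotate i p) (rotate j q))"
    unfolding shuffle_sum_sum by (rule sum.cong[OF refl], rule sum.swap)
  also have "\<dots> = (\<Sum>m<n. ?S (\<lambda>w. f (rotate m w)))"
    by (rule sum.swap)
  also have "\<dots> = of_nat n * ?S f" unfolding rot by simp
  finally show ?thesis using \<open>n > 0\<close> by simp
qed

text \<open>Reversal turns left rotations into right rotations, which only reorders the sum. It
  disposes of the reversed prefix coming from the antipode.\<close>

lemma rotation_sum_rev:
  "(\<Sum>i<length p. h (rev (rotate i p))) = (\<Sum>i<length p. h (rotate i (rev p)) :: rat)"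
proof -
  let ?h = "\<lambda>i. h (rev (rotate i p))"
  have "(\<Sum>i<length p. h (rotate i (rev p))) = (\<Sum>i<length p. ?h (Suc (length p - Suc i)))"
    by (intro sum.cong) (auto simp: rotate_rev Suc_diff_Suc)
  also have "\<dots> = (\<Sum>i<length p. ?h (Suc i))"
    by (rule sum.nat_diff_reindex)
  also have "\<dots> = (\<Sum>i<length p. ?h i)"
    by (rule sum_lessThan_cyclic_shift) simp
  finally show ?thesis by simp
qed

lemma rotation_sum_double_contraction_eq_0:
  assumes "x \<in> HtensL g k" "clift g x \<in> cyc_rel g k" "p \<noteq> []" "q \<noteq> []" "k > 0"
  shows "(\<Sum>i<length p. \<Sum>j<length q. double_contraction g x (rotate i p) (rotate j q)) = 0"
proof -
  have "(\<Sum>i<length p. \<Sum>j<length q. double_contraction g x (rotate i p) (rotate j q)) =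
    (- 1) ^ length p * (\<Sum>i<length p. \<Sum>j<length q. shuffle_sum (clift g x) (rev (rotate i p)) (rotate j q))"
    by (simp add: double_contraction_eq_shuffle_sum[OF assms(1)] sum_distrib_left)
  also have "(\<Sum>i<length p. \<Sum>j<length q. shuffle_sum (clift g x) (rev (rotate i p)) (rotate j q))
    = (\<Sum>i<length p. \<Sum>j<length q. shuffle_sum (clift g x) (rotate i (rev p)) (rotate j q))"
    by (rule rotation_sum_rev[of "\<lambda>p'. \<Sum>j<length q. shuffle_sum (clift g x) p' (rotate j q)"])
  also have "\<dots> = 0"
    using rotation_sum_shuffle_sum_eq_0[of "rev p" q "clift g x" k] cyc_rel_rotation_sum[OF assms(2)] assms
    by simp
  finally show ?thesis by simp
qed

section \<open>Rotations as permutations of the basis words\<close>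

lemma finite_words [simp]: "finite (words g n)"
proof -
  have "words g n = {w. set w \<subseteq> {..<2 * g} \<and> length w = n}" by (auto simp: words_def)
  then show ?thesis by (simp add: finite_lists_length_eq)
qed

lemma rotate_in_words_iff [simp]: "rotate n w \<in> words g m \<longleftrightarrow> w \<in> words g m"
  by (simp add: words_def)

lemma rotate1_in_words_iff [simp]: "rotate1 w \<in> words g m \<longleftrightarrow> w \<in> words g m"
  by (simp add: words_def)

lemma bij_betw_rotate1_words: "bij_betw rotate1 (words g m) (words g m)"
  unfolding bij_betw_def
  by (intro conjI inj_on_subset[OF inj_rotate1] endo_inj_surj) auto

lemma bij_betw_rotate_words: "bij_betw (rotate n) (words g m) (words g m)"
  unfolding rotate_def by (rule bij_betw_funpow[OF bij_betw_rotate1_words])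

section \<open>Cyclic words\<close>

lemma subspace_cyc_rel2: "fun_vs.subspace (cyc_rel2 g k)"
  unfolding cyc_rel2_def lin_span_eq_span by (rule fun_vs.subspace_span)

text \<open>Telescoping over powers of \<open>T\<close> reduces this to one application of
  \<open>T\<close>, where the difference is an explicit combination of the given point-mass
  differences.\<close>

lemma diff_permuted_in_subspace:
  assumes "fun_vs.subspace M" "finite W" and bij: "bij_betw T W W"
    and T: "\<And>a. T a \<in> W \<longleftrightarrow> a \<in> W"
    and F: "\<And>a. a \<notin> W \<Longrightarrow> F a = 0"
    and M: "\<And>a. a \<in> W \<Longrightarrow> (\<lambda>b. of_bool (b = a) - of_bool (b = T a)) \<in> M"
  shows "(\<lambda>a. F a - F ((T ^^ n) a)) \<in> M"
proof (induction n)
  case 0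
  then show ?case using fun_vs.subspace_0[OF assms(1)] by (simp add: zero_fun_def)
next
  case (Suc n)
  define H where "H a = F ((T ^^ n) a)" for a
  have "(T ^^ n) a \<in> W \<longleftrightarrow> a \<in> W" for a
    by (induction n) (auto simp: T)
  then have H: "a \<notin> W \<Longrightarrow> H a = 0" for a by (simp add: F H_def)
  \<comment> \<open>The weights \<open>- H (T a)\<close> are chosen so that reindexing the second
    point masses along \<open>T\<close> leaves \<open>H b - H (T b)\<close>.\<close>
  have "(\<Sum>a\<in>W. (\<lambda>b. - H (T a) * (of_bool (b = a) - of_bool (b = T a)))) \<in> M"
    by (intro fun_vs.subspace_sum[OF assms(1)] fun_vs.subspace_scale[OF assms(1)] M)
  moreover have "(\<Sum>a\<in>W. (\<lambda>b. - H (T a) * (of_bool (b = a) - of_bool (b = T a)))) = (\<lambda>b. H b - H (T b))"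
  proof
    fix b
    have "(\<Sum>a\<in>W. (\<lambda>b. - H (T a) * (of_bool (b = a) - of_bool (b = T a)))) b
       = (\<Sum>a\<in>W. - H (T a) * (of_bool (b = a) - of_bool (b = T a)))"
      using \<open>finite W\<close> by induction auto
    also have "\<dots> = (\<Sum>a\<in>W. H (T a) * of_bool (b = T a)) - (\<Sum>a\<in>W. H (T a) * of_bool (b = a))"
      by (simp add: algebra_simps sum_subtractf)
    also have "(\<Sum>a\<in>W. H (T a) * of_bool (b = T a)) = (\<Sum>a\<in>W. H a * of_bool (b = a))"
      by (rule sum.reindex_bij_betw[OF bij])
    also have "\<dots> = H b"
      using \<open>finite W\<close> H[of b] by (simp add: of_bool_def if_distrib cong: if_cong)
    also have "(\<Sum>a\<in>W. H (T a) * of_bool (b = a)) = H (T b)"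
      using \<open>finite W\<close> H[of "T b"] T[of b] by (simp add: of_bool_def if_distrib cong: if_cong)
    finally show "(\<Sum>a\<in>W. (\<lambda>b. - H (T a) * (of_bool (b = a) - of_bool (b = T a)))) b = H b - H (T b)" .
  qed
  ultimately have "(\<lambda>b. H b - H (T b)) \<in> M" by simp
  from fun_vs.subspace_add[OF assms(1) Suc this] show ?case
    by (simp add: H_def plus_fun_def funpow_swap1)
qed

lemma etens_basis:
  "etens (map (\<lambda>i j. of_bool (j = i)) u) w = of_bool (w = u)"
proof (cases "length w = length u")
  case True
  have "(\<Prod>i<length u. of_bool (w ! i = u ! i)) = (of_bool (\<forall>i<length u. w ! i = u ! i) :: rat)"
    by (auto intro!: prod.neutral prod_zero)
  then show ?thesis using True
    by (simp add: etens_def list_eq_iff_nth_eq)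
qed (auto simp: etens_def)

lemma rotate1_diff_in_cyc_rel2:
  assumes "u \<in> words g p" "v \<in> words g q" "1 \<le> p" "1 \<le> q" "p + q = k"
  shows "(\<lambda>b. of_bool (b = (u, v)) - of_bool (b = (rotate1 u, v))) \<in> cyc_rel2 g k" (is ?L)
    "(\<lambda>b. of_bool (b = (u, v)) - of_bool (b = (u, rotate1 v))) \<in> cyc_rel2 g k" (is ?R)
proof -
  let ?e = "map (\<lambda>i j. of_bool (j = i) :: rat)"
  have eq: "ptens (etens (?e u')) (etens (?e v')) b = of_bool (b = (u', v'))" for u' v' b
    by (cases b) (simp add: ptens_def etens_basis)
  have vecs: "set (?e u) \<subseteq> vecs g" "set (?e v) \<subseteq> vecs g"
    using assms by (auto simp: words_def vecs_def)
  have "(\<lambda>b. ptens (etens (?e u)) (etens (?e v)) b - ptens (etens (rotate1 (?e u))) (etens (?e v)) b)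
      \<in> cyc_rel2 g k"
    unfolding cyc_rel2_def lin_span_eq_span
    by (rule fun_vs.span_base, rule UnI1, rule CollectI, rule exI[of _ "?e u"], rule exI[of _ "?e v"])
       (use assms vecs in \<open>auto simp: words_def\<close>)
  then show ?L by (simp only: rotate1_map eq)
  have "(\<lambda>b. ptens (etens (?e u)) (etens (?e v)) b - ptens (etens (?e u)) (etens (rotate1 (?e v))) b)
      \<in> cyc_rel2 g k"
    unfolding cyc_rel2_def lin_span_eq_span
    by (rule fun_vs.span_base, rule UnI2, rule CollectI, rule exI[of _ "?e u"], rule exI[of _ "?e v"])
       (use assms vecs in \<open>auto simp: words_def\<close>)
  then show ?R by (simp only: rotate1_map eq)
qed

text \<open>A converse to the vanishing of rotation sums, for pairs of words: \<open>F\<close>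
  equals \<open>F\<close> minus its average over rotations, and each \<open>F\<close> minus a
  rotated copy is a cyclic relation.\<close>

lemma in_cyc_rel2_if_rotation_sums_0_bidegree:
  assumes pq: "1 \<le> p" "1 \<le> q" "p + q = k"
    and F: "\<And>b. b \<notin> words g p \<times> words g q \<Longrightarrow> F b = 0"
    and sum: "\<And>u v. u \<in> words g p \<Longrightarrow> v \<in> words g q \<Longrightarrow>
      (\<Sum>i<p. \<Sum>j<q. F (rotate i u, rotate j v)) = 0"
  shows "F \<in> cyc_rel2 g k"
proof -
  let ?W = "words g p \<times> words g q"
  let ?M = "cyc_rel2 g k"
  let ?T1 = "map_prod rotate1 (\<lambda>v. v)" and ?T2 = "map_prod (\<lambda>u. u) rotate1"
  have T1n: "(?T1 ^^ n) (u, v) = (rotate n u, v)" for n and u v :: "nat list"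
    by (induction n) auto
  have T2n: "(?T2 ^^ n) (u, v) = (u, rotate n v)" for n and u v :: "nat list"
    by (induction n) auto
  note bij = bij_betw_map_prod bij_betw_rotate1_words bij_betw_id[unfolded id_def]
  have rot: "(\<lambda>b. F b - F (rotate i (fst b), rotate j (snd b))) \<in> ?M" for i j
  proof -
    have 1: "(\<lambda>a. F a - F ((?T1 ^^ i) a)) \<in> ?M"
      by (rule diff_permuted_in_subspace[OF subspace_cyc_rel2, of ?W])
         (use F pq in \<open>auto intro!: bij rotate1_diff_in_cyc_rel2\<close>)
    have FT: "F ((?T1 ^^ i) a) = 0" if "a \<notin> ?W" for a
      by (rule F) (use that in \<open>cases a, auto simp: T1n\<close>)
    have "(\<lambda>a. F ((?T1 ^^ i) a) - F ((?T1 ^^ i) ((?T2 ^^ j) a))) \<in> ?M"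
      by (rule diff_permuted_in_subspace[OF subspace_cyc_rel2, of ?W])
         (use FT pq in \<open>auto intro!: bij rotate1_diff_in_cyc_rel2\<close>)
    with 1 have "(\<lambda>a. F a - F ((?T1 ^^ i) a)) + (\<lambda>a. F ((?T1 ^^ i) a) - F ((?T1 ^^ i) ((?T2 ^^ j) a))) \<in> ?M"
      by (rule fun_vs.subspace_add[OF subspace_cyc_rel2])
    moreover have "(\<lambda>a. F a - F ((?T1 ^^ i) a)) + (\<lambda>a. F ((?T1 ^^ i) a) - F ((?T1 ^^ i) ((?T2 ^^ j) a)))
        = (\<lambda>b. F b - F (rotate i (fst b), rotate j (snd b)))"
      by (auto simp: fun_eq_iff T1n T2n)
    ultimately show ?thesis by simp
  qed
  have sum': "(\<Sum>i<p. \<Sum>j<q. F (rotate i (fst b), rotate j (snd b))) = 0" for b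
  proof (cases "b \<in> ?W")
    case False
    then have "F (rotate i (fst b), rotate j (snd b)) = 0" for i j
      by (intro F) (auto simp: mem_Times_iff)
    then show ?thesis by simp
  qed (use sum in auto)
  have "(\<lambda>b. 1 / of_nat (p * q) *
      (\<Sum>i<p. \<Sum>j<q. (\<lambda>b. F b - F (rotate i (fst b), rotate j (snd b)))) b) \<in> ?M"
    by (intro fun_vs.subspace_scale[OF subspace_cyc_rel2] fun_vs.subspace_sum[OF subspace_cyc_rel2] rot)
  moreover have "1 / of_nat (p * q) *
      (\<Sum>i<p. \<Sum>j<q. (\<lambda>b. F b - F (rotate i (fst b), rotate j (snd b)))) b = F b" for b
  proof -
    have app: "sum h A b = (\<Sum>a\<in>A. h a b)" for h :: "nat \<Rightarrow> nat list \<times> nat list \<Rightarrow> rat" and A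
      by (induction A rule: infinite_finite_induct) auto
    show ?thesis using pq by (simp add: app sum_subtractf sum')
  qed
  ultimately show ?thesis by simp
qed

lemma in_cyc_rel2_if_rotation_sums_0:
  assumes F: "\<And>u v. F (u, v) \<noteq> 0 \<Longrightarrow>
      \<exists>p q. 1 \<le> p \<and> 1 \<le> q \<and> p + q = k \<and> u \<in> words g p \<and> v \<in> words g q"
    and sum: "\<And>p q u v. 1 \<le> p \<Longrightarrow> 1 \<le> q \<Longrightarrow> p + q = k \<Longrightarrow> u \<in> words g p \<Longrightarrow> v \<in> words g q \<Longrightarrow>
      (\<Sum>i<p. \<Sum>j<q. F (rotate i u, rotate j v)) = 0"
  shows "F \<in> cyc_rel2 g k"
proof -
  let ?F = "\<lambda>p b. if length (fst b) = p then F b else 0"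
  \<comment> \<open>The bidegree components are separated by the length of the first word.\<close>
  have "?F p \<in> cyc_rel2 g k" if "p \<in> {1..<k}" for p
  proof (rule in_cyc_rel2_if_rotation_sums_0_bidegree[of p "k - p"])
    fix u v assume uv: "u \<in> words g p" "v \<in> words g (k - p)"
    then have "length u = p" by (simp add: words_def)
    then show "(\<Sum>i<p. \<Sum>j<k - p. ?F p (rotate i u, rotate j v)) = 0"
      using sum[of p "k - p" u v] uv that by (simp add: Suc_le_eq)
  next
    fix b assume b: "b \<notin> words g p \<times> words g (k - p)"
    show "?F p b = 0"
    proof (rule ccontr)
      assume "?F p b \<noteq> 0"
      then have "F (fst b, snd b) \<noteq> 0" and "length (fst b) = p" by (auto split: if_splits)
      then show False using F[of "fst b" "snd b"] b by (auto simp: words_def mem_Times_iff)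
    qed
  qed (use that in auto)
  then have "(\<Sum>p\<in>{1..<k}. ?F p) \<in> cyc_rel2 g k"
    by (rule fun_vs.subspace_sum[OF subspace_cyc_rel2])
  moreover have "(\<Sum>p\<in>{1..<k}. ?F p) = F"
  proof
    fix b
    have "(\<Sum>p\<in>A. ?F p) b = (\<Sum>p\<in>A. ?F p b)" for A
      by (induction A rule: infinite_finite_induct) auto
    then have "(\<Sum>p\<in>{1..<k}. ?F p) b = (if length (fst b) \<in> {1..<k} then F b else 0)"
      by simp
    also have "\<dots> = F b"
    proof (cases "F b = 0")
      case False
      then show ?thesis using F[of "fst b" "snd b"] by (auto simp: words_def)
    qed simp
    finally show "(\<Sum>p\<in>{1..<k}. ?F p) b = F b" .
  qed
  ultimately show ?thesis by simp
qed

section \<open>The cobracket on cyclically invariant tensors\<close>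

text \<open>The bracket map subtracts from a tensor its rotated copy, so its kernel consists of
  cyclically invariant tensors.\<close>

lemma hQ_rotate:
  assumes "x \<in> hQ g k"
  shows "x (rotate n w) = x w"
proof -
  have "x (rotate1 w) = x w" for w
  proof (cases w)
    case (Cons a w')
    have "bracket_map x (w' @ [a]) = 0" using assms unfolding hQ_def by blast
    then show ?thesis by (simp add: bracket_map_def Cons)
  qed simp
  then show ?thesis by (induction n) auto
qed

lemma omega_skew: "omega g i j = - omega g j i"
  by (auto simp: omega_def)

text \<open>Cyclic invariance brings the second contracted letter to the front. This exchanges
  \<open>u\<close> with \<open>v\<close> and reverses the arguments of the skew form.\<close>

lemma double_contraction_skew:
  assumes "x \<in> hQ g k"
  shows "double_contraction g x v u = - double_contraction g x u v"
proof -
  have "x (i # v @ j # u) = x (j # u @ i # v)" for i j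
    using hQ_rotate[OF assms, of "length (i # v)" "(i # v) @ (j # u)"] by (simp only: rotate_append) simp
  then have "double_contraction g x v u = (\<Sum>i<2 * g. \<Sum>j<2 * g. - (omega g j i * x (j # u @ i # v)))"
    unfolding double_contraction_def using omega_skew[of g] by (intro sum.cong refl) (metis mult_minus_left)
  then show ?thesis
    unfolding double_contraction_def sum_negf by (subst sum.swap) simp
qed

text \<open>Rotating by \<open>i\<close> moves the contracted pair to positions 0 and
  \<open>j - i\<close>. The outer segment, which wraps around the end of \<open>w\<close>, becomes
  an honest suffix, and \<open>x\<close> is unchanged.\<close>

lemma sum_words_contracted_pair:
  assumes "x \<in> hQ g k" "i < j" "j < n" and u: "u \<in> words g p" and v: "v \<in> words g q"
    and n: "p + q + 2 = n"
  shows "(\<Sum>w\<in>words g n. x w * (omega g (w ! i) (w ! j) *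
      (if (u, v) = (take (j - i - 1) (drop (i + 1) w), drop (j + 1) w @ take i w) then 1 else 0)))
    = (if j - i - 1 = p then double_contraction g x u v else 0)" (is "?L = _")
proof -
  define d where "d = j - i"
  define t where "t w = x w * (omega g (w ! 0) (w ! d) *
     (if u = take (d - 1) (drop 1 w) \<and> v = drop (d + 1) w then 1 else 0))" for w
  have d: "1 \<le> d" "d < n" using assms by (auto simp: d_def)
  have "?L = (\<Sum>w\<in>words g n. t (rotate i w))"
  proof (rule sum.cong[OF refl])
    fix w assume "w \<in> words g n"
    then have w: "length w = n" by (simp add: words_def)
    have rot: "rotate i w = drop i w @ take i w" using w assms by (simp add: rotate_drop_take)
 \<comment> \<open>This places position \<open>d\<close> of the rotated word inside
   \<open>drop i w\<close>, before the wrap-around.\<close>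
 have "j - i < n - i" using assms by auto
    then have "rotate i w ! 0 = w ! i" "rotate i w ! d = w ! j"
      using w assms by (simp_all add: rot nth_append d_def)
    moreover have "take (d - 1) (drop 1 (rotate i w)) = take (j - i - 1) (drop (i + 1) w)"
      "drop (d + 1) (rotate i w) = drop (j + 1) w @ take i w"
      using w assms by (simp_all add: rot d_def)
    ultimately show "x w * (omega g (w ! i) (w ! j) *
      (if (u, v) = (take (j - i - 1) (drop (i + 1) w), drop (j + 1) w @ take i w) then 1 else 0))
      = t (rotate i w)"
      by (simp add: t_def hQ_rotate[OF assms(1)])
  qed
  also have "\<dots> = (\<Sum>w\<in>words g n. t w)"
    by (rule sum.reindex_bij_betw[OF bij_betw_rotate_words])
  also have "\<dots> = (if d - 1 = p then double_contraction g x u v else 0)"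
  proof (cases "d - 1 = p")
    case True
    \<comment> \<open>Only words of this shape have inner segment \<open>u\<close> and outer segment
      \<open>v\<close>; the two contracted letters remain free.\<close>
    let ?h = "\<lambda>(a, b). a # u @ b # v"
    let ?A = "{..<2 * g} \<times> {..<2 * g}"
    have lu: "length u = p" and lv: "length v = q" using u v by (auto simp: words_def)
    have d: "d = Suc p" using True d by simp
    have "(\<Sum>w\<in>words g n. t w) = (\<Sum>w\<in>?h ` ?A. t w)"
    proof (rule sum.mono_neutral_right)
      show "?h ` ?A \<subseteq> words g n" using u v n by (auto simp: words_def)
      show "\<forall>w\<in>words g n - ?h ` ?A. t w = 0"
      proof (intro ballI, rule ccontr)
        fix w assume w: "w \<in> words g n - ?h ` ?A" and "t w \<noteq> 0"
        then have uw: "u = take p (drop 1 w)" and vw: "v = drop (Suc (Suc p)) w"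
          by (auto simp: t_def d split: if_splits)
        have len: "length w = n" using w by (simp add: words_def)
        have "w = w ! 0 # drop 1 w"
          using len n by (cases w) auto
        also have "drop 1 w = u @ drop (Suc p) w"
          using append_take_drop_id[of p "drop 1 w"] uw by simp
        also have "drop (Suc p) w = w ! Suc p # v"
          using len n vw by (simp add: Cons_nth_drop_Suc)
        finally have "w = ?h (w ! 0, w ! Suc p)" by simp
        moreover have "w ! m < 2 * g" if "m < n" for m
          using w len nth_mem[of m w] that unfolding words_def by blast
        then have "w ! 0 < 2 * g" "w ! Suc p < 2 * g"
          using n by auto
        ultimately have "w \<in> ?h ` ?A" by blast
        then show False using w by blast
      qed
    qed simp
    also have "\<dots> = (\<Sum>ab\<in>?A. t (?h ab))"
      by (rule sum.reindex_cong[of ?h]) (auto simp: inj_on_def)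
    also have "\<dots> = (\<Sum>a<2 * g. \<Sum>b<2 * g. t (a # u @ b # v))"
      by (simp add: sum.cartesian_product case_prod_unfold)
    also have "\<dots> = double_contraction g x u v"
      by (simp add: t_def d lu double_contraction_def nth_append mult.commute flip: lu)
    finally show ?thesis using True by simp
  next
    case False
    have "t w = 0" if "w \<in> words g n" for w
    proof (rule ccontr)
      assume "t w \<noteq> 0"
      then have "u = take (d - 1) (drop 1 w)" by (auto simp: t_def split: if_splits)
      then show False using False d that u by (auto simp: words_def)
    qed
    then show ?thesis using False by simp
  qed
  finally show ?thesis by (simp add: d_def)
qed

lemma delta_lift_eq_double_contraction:
  assumes x: "x \<in> hQ g k" and pq: "1 \<le> p" "1 \<le> q" "p + q = k"
    and u: "u \<in> words g p" and v: "v \<in> words g q"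
  shows "delta_lift g k x (u, v) = of_nat (k + 2) * double_contraction g x u v"
proof -
  let ?S = "{(i, j). i < j \<and> j < k + 2 \<and> 1 < j - i \<and> j - i < k + 1}"
  have finS: "finite ?S" by (rule finite_subset[of _ "{..<k + 2} \<times> {..<k + 2}"]) auto
  \<comment> \<open>An inner segment of length \<open>r\<close> forces \<open>j = i + r + 1\<close>,
    and \<open>j < k + 2\<close> then leaves the \<open>s + 1\<close> values from 0 to
    \<open>s\<close> for \<open>i\<close>.\<close>
  have count: "(\<Sum>(i, j)\<in>?S. if j - i - 1 = r then c else 0) = of_nat (s + 1) * c"
    if "1 \<le> r" "1 \<le> s" "r + s = k" for r s and c :: rat
  proof -
    have "(\<Sum>(i, j)\<in>?S. if j - i - 1 = r then c else 0) = (\<Sum>(i, j)\<in>{(i, j)\<in>?S. j - i - 1 = r}. c)"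
      using finS by (intro sum.mono_neutral_cong_right) (auto split: if_splits)
    also have "{(i, j)\<in>?S. j - i - 1 = r} = (\<lambda>i. (i, i + r + 1)) ` {..s}"
      using that by (auto simp: image_iff)
    also have "(\<Sum>(i, j)\<in>\<dots>. c) = of_nat (s + 1) * c"
      by (simp add: card_image inj_on_def case_prod_unfold)
    finally show ?thesis .
  qed
  let ?t = "\<lambda>i j uv w. x w * (omega g (w ! i) (w ! j) *
      (if uv = (take (j - i - 1) (drop (i + 1) w), drop (j + 1) w @ take i w) then 1 else 0))"
  have "delta_lift g k x (u, v) =
      (\<Sum>w\<in>words g (k + 2). \<Sum>(i, j)\<in>?S. ?t i j (u, v) w - ?t i j (v, u) w)"
    unfolding delta_lift_def sum_distrib_left
    by (intro sum.cong refl) (auto simp: algebra_simps)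
  also have "\<dots> = (\<Sum>(i, j)\<in>?S. (\<Sum>w\<in>words g (k + 2). ?t i j (u, v) w) - (\<Sum>w\<in>words g (k + 2). ?t i j (v, u) w))"
    by (subst sum.swap) (simp add: case_prod_unfold sum_subtractf)
  also have "\<dots> = (\<Sum>(i, j)\<in>?S. (if j - i - 1 = p then double_contraction g x u v else 0)
      - (if j - i - 1 = q then double_contraction g x v u else 0))"
  proof (rule sum.cong[OF refl], clarify)
    fix i j assume "i < j" "j < k + 2"
    then show "(\<Sum>w\<in>words g (k + 2). ?t i j (u, v) w) - (\<Sum>w\<in>words g (k + 2). ?t i j (v, u) w) =
       (if j - i - 1 = p then double_contraction g x u v else 0)
      - (if j - i - 1 = q then double_contraction g x v u else 0)"
      using pq by (simp only: sum_words_contracted_pair[OF x _ _ u v] sum_words_contracted_pair[OF x _ _ v u])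
  qed
  also have "\<dots> = of_nat (q + 1) * double_contraction g x u v - of_nat (p + 1) * double_contraction g x v u"
    using count[of p q "double_contraction g x u v"] count[of q p "double_contraction g x v u"] pq
    by (simp add: case_prod_unfold sum_subtractf)
  \<comment> \<open>By skewness the two halves of the cobracket add up, and (q + 1) + (p + 1) = k +
    2.\<close>
  also have "\<dots> = of_nat (k + 2) * double_contraction g x u v"
    unfolding double_contraction_skew[OF x, of v u] using pq by (auto simp: algebra_simps)
  finally show ?thesis .
qed

text \<open>The segments have lengths \<open>j - i - 1\<close> and \<open>k + 1 - (j - i)\<close>,
  so the strict bounds on \<open>j - i\<close> are exactly what makes both nonempty.\<close>

lemma delta_lift_support:
  assumes "delta_lift g k x (u, v) \<noteq> 0"
  shows "\<exists>p q. 1 \<le> p \<and> 1 \<le> q \<and> p + q = k \<and> u \<in> words g p \<and> v \<in> words g q"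
proof -
  let ?S = "{(i, j). i < j \<and> j < k + 2 \<and> 1 < j - i \<and> j - i < k + 1}"
  obtain w where w: "w \<in> words g (k + 2)" and "(\<Sum>(i, j)\<in>?S. omega g (w ! i) (w ! j) *
        ((if (u, v) = (take (j - i - 1) (drop (i + 1) w), drop (j + 1) w @ take i w) then 1 else 0)
       - (if (u, v) = (drop (j + 1) w @ take i w, take (j - i - 1) (drop (i + 1) w)) then 1 else 0))) \<noteq> 0"
    using assms unfolding delta_lift_def
    by (elim sum.not_neutral_contains_not_neutral) auto
  then obtain i j where ij: "(i, j) \<in> ?S" and
    uv: "(u, v) = (take (j - i - 1) (drop (i + 1) w), drop (j + 1) w @ take i w) \<or>
     (u, v) = (drop (j + 1) w @ take i w, take (j - i - 1) (drop (i + 1) w))"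
    by (elim sum.not_neutral_contains_not_neutral) (auto split: if_splits)
  have "take (j - i - 1) (drop (i + 1) w) \<in> words g (j - i - 1)"
    "drop (j + 1) w @ take i w \<in> words g (k + 1 - (j - i))"
    using w ij by (auto simp: words_def dest!: in_set_takeD in_set_dropD)
  moreover have "1 \<le> j - i - 1" "1 \<le> k + 1 - (j - i)" "(j - i - 1) + (k + 1 - (j - i)) = k"
    using ij by auto
  ultimately show ?thesis using uv by (metis add.commute prod.inject)
qed

theorem theorem1p1:
  fixes g k :: nat and x :: "nat list \<Rightarrow> rat"
  assumes "1 \<le> g" and "1 \<le> k" and "k + 2 \<le> 2 * g"
    and "x \<in> hQ g k"
    and "clift g x \<in> cyc_rel g k"
  shows "delta_lift g k x \<in> cyc_rel2 g k"
proof (rule in_cyc_rel2_if_rotation_sums_0)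
  fix p q u v assume pq: "1 \<le> p" "1 \<le> q" "p + q = k" and uv: "u \<in> words g p" "v \<in> words g q"
  have "length u = p" "length v = q" using uv by (auto simp: words_def)
  have "x \<in> HtensL g k" using assms(4) by (simp add: hQ_def)
  then have "(\<Sum>i<length u. \<Sum>j<length v. double_contraction g x (rotate i u) (rotate j v)) = 0"
    using assms(2,5) pq uv by (intro rotation_sum_double_contraction_eq_0) (auto simp: words_def)
  moreover have "(\<Sum>i<p. \<Sum>j<q. delta_lift g k x (rotate i u, rotate j v)) =
      of_nat (k + 2) * (\<Sum>i<p. \<Sum>j<q. double_contraction g x (rotate i u) (rotate j v))"
    unfolding sum_distrib_left
    by (intro sum.cong refl delta_lift_eq_double_contraction[OF assms(4) pq]) (use uv in auto)
  ultimately show "(\<Sum>i<p. \<Sum>j<q. delta_lift g k x (rotate i u, rotate j v)) = 0"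
    using \<open>length u = p\<close> \<open>length v = q\<close> by simp
qed (rule delta_lift_support)

end
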